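(* Let $\alpha>0$, let $f\in C([0,\infty))$ with $f(0)\ge 0$, and let $g\in L^1((0,T))$ for all $T>0$. Assume that for some $\tau\in(0,\infty]$ one has $\operatorname{ess\,sup}_{0<t<\tau} g(t)\le 0$ and $G(t)>0$ for all $t\in(0,\tau)$. Let $K_0:=\dfrac{\alpha^{\frac1{\alpha+1}}}{2(\alpha+1)}$. If, for some $\beta>K_0$, $$f(t)\le k_0G(t)-\beta\, G(t)L(t)^2\quad\text{for all }t\in(0,\tau),$$ then the equation $$x(t)=f(t)+\int_0^t\frac{g(s)}{x^\alpha(s)}\,ds$$ has no solution (i.e. no solution on any interval $[0,\delta)$, $\delta>0$).
   Context: Notation: $G(t):=\bigl|(\alpha+1)\int_0^t g(s)\,ds\bigr|^{\frac1{\alpha+1}}$, $L(t):=1/|\ln G(t)|$, and $k_0:=(\alpha+1)\alpha^{-\frac{\alpha}{\alpha+1}}$. (Since $G(t)\to0$ as $t\downarrow0$, $L$ is well defined for small $t>0$; the inequality involving it is understood at the times $t$ where it is defined.) Notion of solution. Put $I(s,x)=g(s)/x^\alpha$ if $x>0$; and, for $x=0$, $I(s,0)=-\infty$, $0$, $+\infty$ according to whether $g(s)<0$, $g(s)=0$, $g(s)>0$. A function $x$ is a solution of the equation on $[0,\delta)$ if it is real, nonnegative and continuous on $[0,\delta)$, $s\mapsto I(s,x(s))$ belongs to $L^1_{\rm loc}((0,\delta))$, and for every $t\in(0,\delta)$ the limit $\int_0^t I(s,x(s))\,ds:=\lim_{\varepsilon\downarrow0}\int_\varepsilon^t I(s,x(s))\,ds$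 exists and $x(t)=f(t)+\int_0^t I(s,x(s))\,ds$. *)

theory Defs
  imports "HOL-Analysis.Analysis" "HOL-Probability.Essential_Supremum"
begin

definition G_of :: "real \<Rightarrow> (real \<Rightarrow> real) \<Rightarrow> real \<Rightarrow> real" where
  "G_of \<alpha> g t = \<bar>(\<alpha> + 1) * (LINT s:{0<..<t}|lebesgue. g s)\<bar> powr (1 / (\<alpha> + 1))"

text \<open>Mathematically \<open>L\<close> is defined only where \<open>0 < G\<close> and \<open>G \<noteq> 1\<close>; elsewhere HOL's total
  functions give a junk value, so statements involving it must be guarded.\<close>

definition L_of :: "real \<Rightarrow> (real \<Rightarrow> real) \<Rightarrow> real \<Rightarrow> real" where
  "L_of \<alpha> g t = 1 / \<bar>ln (G_of \<alpha> g t)\<bar>"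

definition L_defined :: "real \<Rightarrow> (real \<Rightarrow> real) \<Rightarrow> real \<Rightarrow> bool" where
  "L_defined \<alpha> g t \<longleftrightarrow> 0 < G_of \<alpha> g t \<and> ln (G_of \<alpha> g t) \<noteq> 0"

definition k0 :: "real \<Rightarrow> real" where
  "k0 \<alpha> = (\<alpha> + 1) * \<alpha> powr (- (\<alpha> / (\<alpha> + 1)))"

definition K0 :: "real \<Rightarrow> real" where
  "K0 \<alpha> = \<alpha> powr (1 / (\<alpha> + 1)) / (2 * (\<alpha> + 1))"

text \<open>The integrand \<open>I(s, y)\<close>. It is only ever used for \<open>y \<ge> 0\<close>, so the last three
  branches are the case \<open>y = 0\<close>.\<close>

definition integrand :: "real \<Rightarrow> (real \<Rightarrow> real) \<Rightarrow> real \<Rightarrow> real \<Rightarrow> ereal" where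
  "integrand \<alpha> g s y =
     (if y > 0 then ereal (g s / y powr \<alpha>)
      else if g s < 0 then - \<infinity>
      else if g s = 0 then 0
      else \<infinity>)"

text \<open>\<open>L\<^sup>1\<^sub>l\<^sub>o\<^sub>c(S)\<close> for extended-real-valued functions. Finiteness of the integral
  of the absolute value forces the function to be finite almost everywhere on \<open>S\<close>.\<close>

definition locally_L1 :: "(real \<Rightarrow> ereal) \<Rightarrow> real set \<Rightarrow> bool" where
  "locally_L1 h S \<longleftrightarrow>
     (\<forall>K. compact K \<and> K \<subseteq> S \<longrightarrow>
        h \<in> borel_measurable (restrict_space lebesgue K) \<and>
        (\<integral>\<^sup>+ s \<in> K. e2ennreal \<bar>h s\<bar> \<partial>lebesgue) < \<infinity>)"

text \<open>Passing to \<^const>\<open>real_of_ereal\<close> under the integral is harmless: by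
  \<^const>\<open>locally_L1\<close> the integrand is infinite only on a null set.\<close>

definition is_solution ::
  "real \<Rightarrow> (real \<Rightarrow> real) \<Rightarrow> (real \<Rightarrow> real) \<Rightarrow> real \<Rightarrow> (real \<Rightarrow> real) \<Rightarrow> bool" where
  "is_solution \<alpha> f g \<delta> x \<longleftrightarrow>
     (\<forall>t\<in>{0..<\<delta>}. 0 \<le> x t) \<and>
     continuous_on {0..<\<delta>} x \<and>
     locally_L1 (\<lambda>s. integrand \<alpha> g s (x s)) {0<..<\<delta>} \<and>
     (\<forall>t\<in>{0<..<\<delta>}. \<exists>l.
        ((\<lambda>\<epsilon>. LINT s:{\<epsilon>..t}|lebesgue. real_of_ereal (integrand \<alpha> g s (x s)))
           \<longlongrightarrow> l) (at_right 0) \<and>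
        x t = f t + l)"

end

theory Submission imports Defs "HOL-Real_Asymp.Real_Asymp" begin

text \<open>Suppose \<open>x\<close> solves the equation and put \<open>r = G(t)\<close> and \<open>h = f - x\<close>, the integral of \<open>\<bar>g\<bar> / x powr \<alpha>\<close>.
  Since \<open>r powr (\<alpha> + 1)\<close> is \<open>\<alpha> + 1\<close> times the integral of \<open>\<bar>g\<bar>\<close>, the equation says, formally, that
  \<open>dh / dr = (r / x) powr \<alpha>\<close>. In the variables \<open>v = h / r\<close> and \<open>s = - ln r\<close>, with \<open>z = x / r\<close>, this is the
  scalar equation \<open>- dv / ds = z powr (-\<alpha>) - v\<close>, and the hypothesis on \<open>f\<close> reads
  \<open>z + v \<le> k0 - \<beta> / s\<^sup>2\<close>. As \<open>k0\<close> is the minimum of \<open>z powr (-\<alpha>) + z\<close>, the rate \<open>z powr (-\<alpha>) - v\<close> is at least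
  \<open>\<beta> / s\<^sup>2\<close> plus a term quadratic in the distance of \<open>z\<close> from the minimizer
  (\<open>equilibrium_gap_lower_bound\<close>).

  The time \<open>t = 0\<close> corresponds to \<open>s = \<infinity>\<close>, so \<open>v\<close> has to survive for infinite logarithmic time
  while remaining nonnegative. It is decreasing in \<open>s\<close> (\<open>v_mono\<close>) and cannot drop below its critical
  value \<open>v\<^sub>0\<close>, since it would then decrease at a rate bounded away from zero (\<open>v_ge_critical\<close>).
  While \<open>w = v - v\<^sub>0 \<ge> 0\<close>, convexity gives the Riccati inequality
  \<open>- dw / ds \<ge> A w\<^sup>2 + \<beta> / s\<^sup>2\<close> with \<open>1 / (4 A) = K0\<close>. For \<open>p = s w\<close> this becomes
  \<open>- s dp / ds \<ge> A p\<^sup>2 - p + \<beta> \<ge> \<beta> - K0 > 0\<close>, which forces \<open>p\<close> down to minus infinity, against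
  \<open>p \<ge> 0\<close> (\<open>no_trajectory\<close>).

  Since \<open>g\<close> is merely integrable, none of these derivatives need exist everywhere. Each of the three
  arguments shows that a functional of the form \<open>a(r) h + b(r)\<close> with \<open>a > 0\<close> is nondecreasing
  in \<open>t\<close>, and for such functionals a lower bound on the increments of \<open>h\<close> over short intervals is
  enough (\<open>affine_functional_nondecreasing\<close>).\<close>

section \<open>Monotonicity from local comparison on the right\<close>

text \<open>The supremum of the points where \<open>Q\<close> has not dropped below \<open>Q a\<close> is itself such a
  point, and the local hypothesis pushes past it. This replaces differentiation, which is not
  available because the trajectories below need not be differentiable everywhere.\<close>
lemma nondecreasing_if_locally_above_on_right:
  fixes Q :: "real \<Rightarrow> real"
  assumes "a \<le> b" and cont: "continuous_on {a..b} Q"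
    and right: "\<And>t. a \<le> t \<Longrightarrow> t < b \<Longrightarrow> eventually (\<lambda>t'. Q t \<le> Q t') (at_right t)"
  shows "Q a \<le> Q b"
proof -
  define S where "S = {t \<in> {a..b}. Q a \<le> Q t}"
  have "closed S"
    unfolding S_def by (intro continuous_on_closed_Collect_le cont continuous_intros closed_atLeastAtMost)
  have ne: "a \<in> S" "bdd_above S" using assms(1) by (auto simp: S_def bdd_above_def)
  define m where "m = Sup S"
  have mS: "m \<in> S" unfolding m_def using closed_contains_Sup[of S] ne \<open>closed S\<close> by auto
  show ?thesis
  proof (cases "m = b")
    case True then show ?thesis using mS by (simp add: S_def)
  next
    case False
    then have m: "a \<le> m" "m < b" "Q a \<le> Q m" using mS by (auto simp: S_def)
    from right[OF m(1,2)] obtain c where c: "c > m" "\<And>t'. m < t' \<Longrightarrow> t' < c \<Longrightarrow> Q m \<le> Q t'"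
      by (auto simp: eventually_at_right_field)
    define t where "t = (m + min b c) / 2"
    have t: "m < t" "t < c" "t < b" using c m unfolding t_def by (auto simp: min_def)
    then have "t \<in> S" using c(2)[of t] m by (auto simp: S_def)
    then have "t \<le> m" unfolding m_def using ne by (intro cSup_upper) auto
    with t show ?thesis by simp
  qed
qed

section \<open>The critical slope\<close>

text \<open>With \<open>f = k0 G\<close>, a solution of the form \<open>x = z G\<close> exists iff \<open>z powr (-\<alpha>) + z = k0\<close>. The left-hand
  side has \<open>k0\<close> as its minimum, attained only at this value of \<open>z\<close>; this is why the constant
  \<open>k0\<close> is critical.\<close>
definition crit_slope :: "real \<Rightarrow> real" where "crit_slope \<alpha> = \<alpha> powr (1 / (\<alpha> + 1))"

lemma crit_slope_pos: "\<alpha> > 0 \<Longrightarrow> crit_slope \<alpha> > 0" by (simp add: crit_slope_def)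

lemma crit_stationary:
  assumes "\<alpha> > 0" shows "\<alpha> * crit_slope \<alpha> powr (- \<alpha> - 1) = 1"
proof -
  have "(1 / (\<alpha> + 1)) * (- \<alpha> - 1) = -1" using assms by (simp add: field_simps)
  then have "crit_slope \<alpha> powr (- \<alpha> - 1) = \<alpha> powr (-1)" unfolding crit_slope_def powr_powr by simp
  then show ?thesis using assms by (simp add: powr_minus)
qed

lemma k0_eq: assumes "\<alpha> > 0" shows "k0 \<alpha> = crit_slope \<alpha> powr (-\<alpha>) + crit_slope \<alpha>"
proof -
  have "crit_slope \<alpha> powr (-\<alpha>) = \<alpha> powr (- (\<alpha> / (\<alpha> + 1)))"
    unfolding crit_slope_def powr_powr by simp
  moreover have "\<alpha> * \<alpha> powr (- (\<alpha> / (\<alpha> + 1))) = crit_slope \<alpha>"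
  proof -
    have "\<alpha> * \<alpha> powr (- (\<alpha> / (\<alpha> + 1))) = \<alpha> powr (1 + - (\<alpha> / (\<alpha> + 1)))"
      using assms by (subst powr_add) simp
    also have "1 + - (\<alpha> / (\<alpha> + 1)) = 1 / (\<alpha> + 1)" using assms by (simp add: field_simps)
    finally show ?thesis by (simp add: crit_slope_def)
  qed
  ultimately show ?thesis by (simp add: k0_def algebra_simps)
qed

text \<open>The second derivative of \<open>z powr (-\<alpha>) + z\<close> decreases in \<open>z\<close>, so on \<open>{0<..Z}\<close> it is at
  least its value at \<open>Z\<close>. Subtracting the corresponding parabola therefore leaves a convex
  function, which lies above its horizontal tangent at \<open>crit_slope \<alpha>\<close>. Taking \<open>Z\<close> equal to
  \<open>crit_slope \<alpha>\<close> gives the exact curvature at the minimum, with no error term; that exactness is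
  what reaches every \<open>\<beta> > K0\<close>.\<close>

lemma equilibrium_gap_lower_bound:
  assumes "\<alpha> > 0" "0 < z" "z \<le> Z" "crit_slope \<alpha> \<le> Z"
  shows "k0 \<alpha> + \<alpha> * (\<alpha> + 1) / 2 * Z powr (- \<alpha> - 2) * (z - crit_slope \<alpha>)\<^sup>2 \<le> z powr (-\<alpha>) + z"
proof -
  let ?c = "crit_slope \<alpha>"
  define B where "B = \<alpha> * (\<alpha> + 1) / 2 * Z powr (- \<alpha> - 2)"
  define F where "F = (\<lambda>z. z powr (-\<alpha>) + z - B * (z - ?c)\<^sup>2)"
  define F' where "F' = (\<lambda>z. - \<alpha> * z powr (-\<alpha> - 1) + 1 - 2 * B * (z - ?c))"
  define F'' where "F'' = (\<lambda>z. \<alpha> * (\<alpha> + 1) * z powr (-\<alpha> - 2) - 2 * B)"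
  have c: "?c > 0" using assms crit_slope_pos by auto
  have "F' ?c * (z - ?c) \<le> F z - F ?c"
  proof (rule f''_imp_f'[of "{0<..Z}" F F' F''])
    show "convex {0<..Z}" by simp
    fix x assume x: "x \<in> {0<..Z}"
    show "(F has_real_derivative F' x) (at x)"
      unfolding F_def F'_def using x by (auto intro!: derivative_eq_intros simp: power2_eq_square)
    show "(F' has_real_derivative F'' x) (at x)"
      unfolding F''_def F'_def using x by (auto intro!: derivative_eq_intros simp: algebra_simps)
    have "Z powr (-\<alpha> - 2) \<le> x powr (-\<alpha> - 2)" using x assms by (intro powr_mono2') auto
    then show "0 \<le> F'' x" unfolding F''_def B_def using assms by (simp add: mult_left_mono)
  qed (use assms c in auto)
  moreover have "F' ?c = 0" using crit_stationary[OF assms(1)] by (simp add: F'_def)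
  ultimately have "F ?c \<le> F z" by simp
  then show ?thesis unfolding F_def B_def k0_eq[OF assms(1)] by simp
qed

text \<open>Where \<open>K0\<close> comes from: with \<open>A\<close> the constant of the preceding bound for \<open>Z = crit_slope \<alpha>\<close>,
  the quadratic \<open>A p\<^sup>2 - p + b\<close> is positive for all real \<open>p\<close> iff \<open>b > 1 / (4 A)\<close>, that is, iff
  \<open>b > K0 \<alpha>\<close>.\<close>

lemma K0_eq_inverse_curvature: assumes "\<alpha> > 0"
  shows "4 * (\<alpha> * (\<alpha> + 1) / 2 * crit_slope \<alpha> powr (- \<alpha> - 2)) * K0 \<alpha> = 1"
proof -
  have "crit_slope \<alpha> powr (-\<alpha> - 1) = crit_slope \<alpha> powr (- \<alpha> - 2 + 1)"
    by (rule arg_cong[where f = "\<lambda>e. crit_slope \<alpha> powr e"]) simp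
  also have "\<dots> = crit_slope \<alpha> powr (-\<alpha> - 2) * crit_slope \<alpha>"
    using crit_slope_pos[OF assms] by (subst powr_add) simp
  finally have "\<alpha> * (crit_slope \<alpha> powr (- \<alpha> - 2) * crit_slope \<alpha>) = 1"
    using crit_stationary[OF assms] by simp
  moreover have "K0 \<alpha> = crit_slope \<alpha> / (2 * (\<alpha> + 1))" by (simp add: K0_def crit_slope_def)
  then have "4 * (\<alpha> * (\<alpha> + 1) / 2 * crit_slope \<alpha> powr (- \<alpha> - 2)) * K0 \<alpha>
      = \<alpha> * (crit_slope \<alpha> powr (- \<alpha> - 2) * crit_slope \<alpha>)"
    using assms by (simp add: divide_simps) (simp add: algebra_simps)
  ultimately show ?thesis by simp
qed

section \<open>Monotone functionals of a trajectory\<close>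

text \<open>The setting for \<open>r = G\<close> and \<open>h = f - x\<close>. The last assumption is the integrated form of
  \<open>dh / dr = (r / x) powr \<alpha>\<close>, written as an inequality between increments: nothing has to be
  differentiable, and intervals where \<open>r\<close> is constant and points where \<open>x = 0\<close> are covered.\<close>
locale singular_growth =
  fixes \<alpha> T :: real and r h x :: "real \<Rightarrow> real"
  assumes alpha_pos: "\<alpha> > 0" and T_pos: "T > 0"
    and r_cont: "continuous_on {0<..<T} r"
    and h_cont: "continuous_on {0<..<T} h"
    and x_cont: "continuous_on {0<..<T} x"
    and r_pos: "\<And>t. 0 < t \<Longrightarrow> t < T \<Longrightarrow> 0 < r t"
    and r_mono: "\<And>t t'. 0 < t \<Longrightarrow> t \<le> t' \<Longrightarrow> t' < T \<Longrightarrow> r t \<le> r t'"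
    and growth: "\<And>t t' y. 0 < t \<Longrightarrow> t \<le> t' \<Longrightarrow> t' < T \<Longrightarrow> 0 < y \<Longrightarrow> (\<forall>s\<in>{t..t'}. x s < y) \<Longrightarrow>
       y powr (-\<alpha>) * ((r t' powr (\<alpha> + 1) - r t powr (\<alpha> + 1)) / (\<alpha> + 1)) \<le> h t' - h t"
begin

text \<open>The condition \<open>rate\<close> is the chain rule for \<open>a(r) h + b(r)\<close> with \<open>dh / dr\<close> replaced by the smaller
  \<open>z powr (-\<alpha>)\<close>. Replacing the growth of \<open>h\<close> by this smaller rate only decreases the
  functional, since \<open>a(r) > 0\<close>; what remains depends on \<open>r\<close> alone, where ordinary
  differentiation applies. Because \<open>x t < r t * z\<close> is strict, the replacement is valid on a right
  neighbourhood of \<open>t\<close>.\<close>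
lemma affine_functional_nondecreasing:
  fixes a b a' b' :: "real \<Rightarrow> real"
  assumes S: "S \<le> T"
    and da: "\<And>t. 0 < t \<Longrightarrow> t < S \<Longrightarrow> (a has_real_derivative a' (r t)) (at (r t))"
    and db: "\<And>t. 0 < t \<Longrightarrow> t < S \<Longrightarrow> (b has_real_derivative b' (r t)) (at (r t))"
    and apos: "\<And>t. 0 < t \<Longrightarrow> t < S \<Longrightarrow> 0 < a (r t)"
    and rate: "\<And>t. 0 < t \<Longrightarrow> t < S \<Longrightarrow>
       \<exists>z>0. x t < r t * z \<and> 0 < a' (r t) * h t + a (r t) * z powr (-\<alpha>) + b' (r t)"
    and t: "0 < t1" "t1 \<le> t2" "t2 < S"
  shows "a (r t1) * h t1 + b (r t1) \<le> a (r t2) * h t2 + b (r t2)"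
proof (rule nondecreasing_if_locally_above_on_right[OF t(2)])
  have sub: "{t1..t2} \<subseteq> {0<..<T}" using t S by auto
  have ac: "isCont a (r t)" and bc: "isCont b (r t)" if "t \<in> {t1..t2}" for t
    using da[of t] db[of t] that t by (auto intro: DERIV_isCont)
  have cr: "continuous_on {t1..t2} r" using r_cont sub continuous_on_subset by blast
  have "continuous_on (r ` {t1..t2}) a" "continuous_on (r ` {t1..t2}) b"
    using ac bc by (auto intro!: continuous_at_imp_continuous_on)
  then have "continuous_on {t1..t2} (\<lambda>t. a (r t))" "continuous_on {t1..t2} (\<lambda>t. b (r t))"
    using continuous_on_compose2[OF _ cr] by blast+
  moreover have "continuous_on {t1..t2} h" using h_cont sub continuous_on_subset by blast
  ultimately show "continuous_on {t1..t2} (\<lambda>t. a (r t) * h t + b (r t))"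
    by (intro continuous_intros)
  fix t assume tt: "t1 \<le> t" "t < t2"
  then have t0: "0 < t" "t < S" "t < T" using t S by auto
  from rate[OF t0(1,2)] obtain z where z: "0 < z" "x t < r t * z"
    "0 < a' (r t) * h t + a (r t) * z powr (-\<alpha>) + b' (r t)" by blast
  have rt: "r t > 0" using r_pos t0 by auto
  define y where "y = r t * z"
  have y: "y > 0" "x t < y" using z rt by (auto simp: y_def)
  have lim: "(q \<longlongrightarrow> q t) (at_right t)" if "continuous_on {0<..<T} q" for q :: "real \<Rightarrow> real"
  proof -
    have "isCont q t" using that t0 by (simp add: continuous_on_eq_continuous_at)
    then show ?thesis unfolding continuous_at by (rule tendsto_within_subset) simp
  qed
  \<comment> \<open>The functional as it would evolve if \<open>h\<close> grew exactly at the guaranteed rate, as a function of \<open>r\<close>.\<close>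
  define D where "D = (\<lambda>\<rho>. a \<rho> * (h t + y powr (-\<alpha>) * ((\<rho> powr (\<alpha> + 1) - r t powr (\<alpha> + 1)) / (\<alpha> + 1))) + b \<rho>)"
  have "y powr (-\<alpha>) * r t powr \<alpha> = z powr (-\<alpha>)"
    unfolding y_def using rt z by (simp add: powr_mult powr_minus field_simps)
  then have eq: "a' (r t) * h t + a (r t) * z powr (-\<alpha>) + b' (r t)
       = a' (r t) * h t + a (r t) * (y powr (-\<alpha>) * r t powr \<alpha>) + b' (r t)" by simp
  have "((\<lambda>\<rho>. (\<rho> powr (\<alpha> + 1) - r t powr (\<alpha> + 1)) / (\<alpha> + 1)) has_real_derivative r t powr \<alpha>) (at (r t))"
    using rt alpha_pos by (auto intro!: derivative_eq_intros)
  then have "(D has_real_derivative (a' (r t) * h t + a (r t) * z powr (-\<alpha>) + b' (r t))) (at (r t))"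
    unfolding D_def eq using rt alpha_pos
    by (auto intro!: derivative_eq_intros da db t0)
  from DERIV_pos_inc_right[OF this z(3)] obtain d where d: "d > 0"
    "\<And>e. 0 < e \<Longrightarrow> e < d \<Longrightarrow> D (r t) < D (r t + e)" by blast
  have "eventually (\<lambda>t'. x t' < y) (at_right t)"
    using order_tendstoD(2)[OF lim[OF x_cont] y(2)] .
  then obtain c where c: "c > t" "\<And>s. t < s \<Longrightarrow> s < c \<Longrightarrow> x s < y"
    by (auto simp: eventually_at_right_field)
  have "eventually (\<lambda>t'. r t' < r t + d) (at_right t)"
    using order_tendstoD(2)[OF lim[OF r_cont], of "r t + d"] d by auto
  moreover have "eventually (\<lambda>t'. t' < c \<and> t' < S \<and> t < t') (at_right t)"
    using c t0 by (auto simp: eventually_at_right_field intro!: exI[of _ "min c S"])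
  ultimately show "eventually (\<lambda>t'. a (r t) * h t + b (r t) \<le> a (r t') * h t' + b (r t')) (at_right t)"
  proof eventually_elim
    case (elim t')
    have t': "t \<le> t'" "t' < T" "0 < t'" "t' < S" using elim t0 S by auto
    have "D (r t) \<le> D (r t')"
      using d(2)[of "r t' - r t"] r_mono[OF t0(1) t'(1,2)] elim
      by (cases "r t' = r t") auto
    also have "\<dots> \<le> a (r t') * h t' + b (r t')"
    proof -
      have "y powr (-\<alpha>) * ((r t' powr (\<alpha> + 1) - r t powr (\<alpha> + 1)) / (\<alpha> + 1)) \<le> h t' - h t"
      proof (rule growth[OF t0(1) t'(1,2) y(1)], intro ballI)
        fix s assume "s \<in> {t..t'}" then show "x s < y" using c(2)[of s] y elim by (cases "s = t") auto
      qed
      then show ?thesis unfolding D_def using apos[OF t'(3,4)] by (simp add: mult_left_mono)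
    qed
    finally show ?case by (simp add: D_def)
  qed
qed

end

section \<open>Forcing below the critical barrier\<close>

text \<open>In the proofs below, \<open>v = h / r\<close>, \<open>s = - ln r\<close>, and \<open>v\<^sub>0\<close> is the value of \<open>v\<close> for the
  critical solution with forcing \<open>k0 r\<close>.\<close>
locale subcritical_forcing = singular_growth +
  fixes \<beta> :: real
  assumes x_nonneg: "\<And>t. 0 < t \<Longrightarrow> t < T \<Longrightarrow> 0 \<le> x t"
    and h_nonneg: "\<And>t. 0 < t \<Longrightarrow> t < T \<Longrightarrow> 0 \<le> h t"
    and r_less_1: "\<And>t. 0 < t \<Longrightarrow> t < T \<Longrightarrow> r t < 1"
    and r_lim: "(r \<longlongrightarrow> 0) (at_right 0)"
    and beta: "\<beta> > K0 \<alpha>"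
    and forcing: "\<And>t. 0 < t \<Longrightarrow> t < T \<Longrightarrow> x t + h t \<le> k0 \<alpha> * r t - \<beta> * r t * (1 / \<bar>ln (r t)\<bar>)\<^sup>2"
begin

abbreviation "v t \<equiv> h t / r t"
abbreviation "c \<equiv> crit_slope \<alpha>"
abbreviation "v\<^sub>0 \<equiv> c powr (-\<alpha>)"
abbreviation "curv Z \<equiv> \<alpha> * (\<alpha> + 1) / 2 * Z powr (- \<alpha> - 2)"

lemma K0_pos: "K0 \<alpha> > 0" using alpha_pos by (simp add: K0_def)

text \<open>Any \<open>b < \<beta>\<close> turns the forcing bound into a strict bound on \<open>x\<close>, as
  the functional argument requires; \<open>z\<close> is the resulting bound on \<open>x / r\<close>. In the variable \<open>s\<close>,
  \<open>z powr (-\<alpha>) - v\<close> bounds \<open>- dv / ds\<close> from below, and since \<open>z + v = k0 - b / s\<^sup>2\<close> it equals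
  \<open>b / s\<^sup>2\<close> plus the gap of \<open>z powr (-\<alpha>) + z\<close> above its minimum.\<close>
lemma logarithmic_slope_bound:
  assumes t: "0 < t" "t < T" and b: "0 < b" "b < \<beta>"
  defines "z \<equiv> k0 \<alpha> - b / (ln (r t))\<^sup>2 - v t"
  shows "0 < z" "x t < r t * z" "z \<le> k0 \<alpha>"
    "\<And>Z. z \<le> Z \<Longrightarrow> c \<le> Z \<Longrightarrow> b / (ln (r t))\<^sup>2 + curv Z * (z - c)\<^sup>2 \<le> z powr (-\<alpha>) - v t"
proof -
  have r: "0 < r t" "r t < 1" using r_pos r_less_1 t by auto
  then have ln: "ln (r t) < 0" by simp
  have "x t \<le> r t * (k0 \<alpha> - \<beta> / (ln (r t))\<^sup>2 - v t)"
    using forcing[OF t] r by (simp add: algebra_simps power_divide)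
  also have "\<dots> < r t * z"
    using r b ln unfolding z_def by (simp add: divide_strict_right_mono)
  finally show *: "x t < r t * z" .
  then have "0 < r t * z" using x_nonneg[OF t] by linarith
  then show "0 < z" using r by (simp add: zero_less_mult_iff)
  show "z \<le> k0 \<alpha>" 
  proof -
    have "0 \<le> b / (ln (r t))\<^sup>2" "0 \<le> v t" using h_nonneg[OF t] r b by simp_all
    then show ?thesis unfolding z_def by linarith
  qed
  fix Z assume "z \<le> Z" "c \<le> Z"
  from equilibrium_gap_lower_bound[OF alpha_pos \<open>0 < z\<close> this]
  show "b / (ln (r t))\<^sup>2 + curv Z * (z - c)\<^sup>2 \<le> z powr (-\<alpha>) - v t"
    using z_def by linarith
qed

lemma v_mono:
  assumes "0 < t1" "t1 \<le> t2" "t2 < T"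
  shows "v t1 \<le> v t2"
proof -
  from K0_pos beta obtain b where b: "0 < b" "b < \<beta>" using dense[of 0 \<beta>] by auto
  have "(1 / r t1) * h t1 + 0 \<le> (1 / r t2) * h t2 + 0"
  proof (rule affine_functional_nondecreasing[where a = "\<lambda>\<rho>. 1 / \<rho>" and a' = "\<lambda>\<rho>. - 1 / \<rho>\<^sup>2" and b = "\<lambda>_. 0" and b' = "\<lambda>_. 0" and S = T])
    fix t assume t: "0 < t" "t < T"
    have r: "0 < r t" "ln (r t) \<noteq> 0" using r_pos[OF t] r_less_1[OF t] by auto
    show "((/) 1 has_real_derivative - 1 / (r t)\<^sup>2) (at (r t))"
      using r by (auto intro!: derivative_eq_intros simp: power2_eq_square)
    define z where "z = k0 \<alpha> - b / (ln (r t))\<^sup>2 - v t"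
    note zb = logarithmic_slope_bound[OF t b, folded z_def]
    have "0 \<le> curv (max z c) * (z - c)\<^sup>2" using alpha_pos by simp
    moreover have "0 < b / (ln (r t))\<^sup>2" using b r by simp
    ultimately have "0 < z powr (-\<alpha>) - v t" using zb(4)[of "max z c"] by simp
    then have "0 < (z powr (-\<alpha>) - v t) / r t" using r by simp
    also have "\<dots> = - 1 / (r t)\<^sup>2 * h t + 1 / r t * z powr - \<alpha> + 0"
      using r(1) by (simp add: field_simps power2_eq_square)
    finally show "\<exists>z>0. x t < r t * z \<and> 0 < - 1 / (r t)\<^sup>2 * h t + 1 / r t * z powr - \<alpha> + 0"
      using zb(1,2) by blast
  qed (use assms r_pos in auto)
  then show ?thesis by simp
qed

lemma neg_ln_r_at_top: "filterlim (\<lambda>t. - ln (r t)) at_top (at_right 0)"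
proof -
  have "eventually (\<lambda>t. r t > 0) (at_right 0)"
    using T_pos r_pos by (auto simp: eventually_at_right_field)
  then have "filterlim r (at_right 0) (at_right 0)" 
    using r_lim by (auto simp: filterlim_at elim: eventually_mono)
  then show ?thesis using filterlim_compose[OF ln_at_0] filterlim_uminus_at_top_at_bot filterlim_compose by blast
qed

text \<open>If \<open>v\<close> were below \<open>v\<^sub>0\<close> at one time then, \<open>v\<close> being nondecreasing in \<open>t\<close>, it would stay below
  by a fixed amount at all earlier times. Then \<open>- dv / ds\<close> is bounded below by some \<open>m > 0\<close>, so
  \<open>v + m s\<close> is nondecreasing in \<open>t\<close>, although it tends to infinity as \<open>t\<close> tends to \<open>0\<close>
  because \<open>v \<ge> 0\<close>.\<close>
lemma v_ge_critical:
  assumes t1: "0 < t1" "t1 < T"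
  shows "v\<^sub>0 \<le> v t1"
proof (rule ccontr)
  assume "\<not> v\<^sub>0 \<le> v t1"
  define e where "e = v\<^sub>0 - v t1"
  have e: "e > 0" using \<open>\<not> _\<close> by (simp add: e_def)
  from K0_pos beta obtain b where b: "0 < b" "b < \<beta>" using dense[of 0 \<beta>] by auto
  \<comment> \<open>Here \<open>z\<close> lies to the right of the minimum, where only the weaker curvature at \<open>k0\<close> is available.\<close>
  define m where "m = curv (k0 \<alpha>) * (e / 2)\<^sup>2"
  have c: "c > 0" using crit_slope_pos alpha_pos by auto
  have k: "k0 \<alpha> > 0" "c \<le> k0 \<alpha>" using c k0_eq[OF alpha_pos] by (simp_all add: add_pos_pos)
  have m: "m > 0" using e k alpha_pos by (simp add: m_def)
  have "((\<lambda>t. b / (ln (r t))\<^sup>2) \<longlongrightarrow> 0) (at_right 0)"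
  proof -
    have "((\<lambda>s::real. b / s\<^sup>2) \<longlongrightarrow> 0) at_top" by real_asymp
    from filterlim_compose[OF this neg_ln_r_at_top] show ?thesis by simp
  qed
  then have "eventually (\<lambda>t. b / (ln (r t))\<^sup>2 < e / 2) (at_right 0)"
    by (rule order_tendstoD(2)) (use e in simp)
  then obtain S0 where S0: "S0 > 0" "\<And>t. 0 < t \<Longrightarrow> t < S0 \<Longrightarrow> b / (ln (r t))\<^sup>2 < e / 2"
    by (auto simp: eventually_at_right_field)
  define S where "S = min S0 t1"
  have S: "S > 0" "S \<le> T" using S0 t1 by (auto simp: S_def)
  have mono: "(1 / r t) * h t + (- m * ln (r t)) \<le> (1 / r t') * h t' + (- m * ln (r t'))"
    if tt: "0 < t" "t \<le> t'" "t' < S" for t t'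
  proof (rule affine_functional_nondecreasing[where a = "\<lambda>\<rho>. 1 / \<rho>" and a' = "\<lambda>\<rho>. - 1 / \<rho>\<^sup>2" and b = "\<lambda>\<rho>. - m * ln \<rho>" and b' = "\<lambda>\<rho>. - m / \<rho>" and S = S])
    fix t assume t0: "0 < t" "t < S"
    then have t: "0 < t" "t < T" using S by auto
    have r: "0 < r t" "ln (r t) \<noteq> 0" using r_pos[OF t] r_less_1[OF t] by auto
    show "((/) 1 has_real_derivative - 1 / (r t)\<^sup>2) (at (r t))"
      using r by (auto intro!: derivative_eq_intros simp: power2_eq_square)
    show "((\<lambda>\<rho>. - m * ln \<rho>) has_real_derivative - m / r t) (at (r t))"
      using r by (auto intro!: derivative_eq_intros)
    define z where "z = k0 \<alpha> - b / (ln (r t))\<^sup>2 - v t"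
    note zb = logarithmic_slope_bound[OF t b, folded z_def]
    have "v t \<le> v t1" using v_mono[of t t1] t0 t1 by (auto simp: S_def)
    moreover have "b / (ln (r t))\<^sup>2 < e / 2" using S0(2)[of t] t0 by (simp add: S_def)
    ultimately have "e / 2 \<le> z - c"
      unfolding z_def e_def k0_eq[OF alpha_pos] by argo
    then have "(e / 2)\<^sup>2 \<le> (z - c)\<^sup>2" using e by (intro power_mono) auto
    then have "m \<le> curv (k0 \<alpha>) * (z - c)\<^sup>2" unfolding m_def using alpha_pos by (intro mult_left_mono) auto
    moreover have "0 < b / (ln (r t))\<^sup>2" using b r by simp
    ultimately have "0 < z powr (-\<alpha>) - v t - m" using zb(4)[of "k0 \<alpha>"] zb(3) k by simp
    then have "0 < (z powr (-\<alpha>) - v t - m) / r t" using r by simp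
    also have "\<dots> = - 1 / (r t)\<^sup>2 * h t + 1 / r t * z powr - \<alpha> + - m / r t"
      using r(1) by (simp add: field_simps power2_eq_square)
    finally show "\<exists>z>0. x t < r t * z \<and> 0 < - 1 / (r t)\<^sup>2 * h t + 1 / r t * z powr - \<alpha> + - m / r t"
      using zb(1,2) by blast
  qed (use that S r_pos in auto)
  define C where "C = (1 / r (S/2)) * h (S/2) + (- m * ln (r (S/2)))"
  have "eventually (\<lambda>t. - ln (r t) > C / m) (at_right 0)"
    using neg_ln_r_at_top by (auto simp: filterlim_at_top_dense)
  moreover have "eventually (\<lambda>t. 0 < t \<and> t < S/2) (at_right 0)"
    using S by (auto simp: eventually_at_right_field intro!: exI[of _ "S/2"])
  ultimately have "eventually (\<lambda>t. False) (at_right (0::real))"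
  proof eventually_elim
    case (elim t)
    have "0 \<le> (1 / r t) * h t" using h_nonneg[of t] r_pos[of t] elim S by auto
    moreover have "(1 / r t) * h t + (- m * ln (r t)) \<le> C" unfolding C_def using elim S by (intro mono) auto
    ultimately show False using elim m by (simp add: field_simps)
  qed
  then show False by simp
qed

text \<open>The Riccati inequality \<open>- dw / ds \<ge> A w\<^sup>2 + b / s\<^sup>2\<close> for \<open>w = v - v\<^sub>0 \<ge> 0\<close> is scale invariant, so
  \<open>p = s w\<close> is the natural variable, and \<open>- s dp / ds \<ge> A p\<^sup>2 - p + b\<close>. For \<open>b > K0\<close> the right-hand
  side exceeds a constant \<open>\<kappa> > 0\<close>. Hence \<open>p + \<kappa> ln s\<close> is nondecreasing in \<open>t\<close>, but it
  tends to infinity as \<open>t\<close> tends to \<open>0\<close> since \<open>p \<ge> 0\<close>. It is affine in \<open>h\<close>, as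
  the functional argument requires.\<close>
lemma no_trajectory: False
proof -
  \<comment> \<open>Two values between \<open>K0\<close> and \<open>\<beta>\<close>: one is given up for strictness in the bound on \<open>x\<close>, one to leave room for \<open>\<kappa>\<close>.\<close>
  obtain b1 where b1: "K0 \<alpha> < b1" "b1 < \<beta>" using dense beta by blast
  obtain b2 where b2: "K0 \<alpha> < b2" "b2 < b1" using dense b1 by blast
  define \<kappa> where "\<kappa> = b1 - b2"
  have kap: "\<kappa> > 0" using b2 by (simp add: \<kappa>_def)
  have b: "0 < b1" "b1 < \<beta>" using b1 K0_pos by auto
  let ?A = "curv c"
  have c: "c > 0" using crit_slope_pos alpha_pos by auto
  have A: "?A > 0" "4 * ?A * K0 \<alpha> = 1" using alpha_pos c K0_eq_inverse_curvature[OF alpha_pos] by auto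
  have quad: "0 < ?A * p\<^sup>2 - p + b2" for p
  proof -
    have "0 \<le> (2 * ?A * p - 1)\<^sup>2" by simp
    also have "(2 * ?A * p - 1)\<^sup>2 = 4 * ?A * (?A * p\<^sup>2 - p + K0 \<alpha>)"
      using A(2) by (simp add: power2_eq_square algebra_simps)
    finally have "0 \<le> ?A * p\<^sup>2 - p + K0 \<alpha>" using A(1) by (simp add: zero_le_mult_iff)
    then show ?thesis using b2 by simp
  qed
  let ?Q = "\<lambda>t. (- ln (r t) / r t) * h t + (v\<^sub>0 * ln (r t) + \<kappa> * ln (- ln (r t)))"
  \<comment> \<open>In the notation above, \<open>?Q\<close> is \<open>p + \<kappa> ln s\<close>.\<close>
  have mono: "?Q t \<le> ?Q t'"
    if tt: "0 < t" "t \<le> t'" "t' < T" for t t'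
  proof (rule affine_functional_nondecreasing[where a = "\<lambda>\<rho>. - ln \<rho> / \<rho>" and a' = "\<lambda>\<rho>. (ln \<rho> - 1) / \<rho>\<^sup>2"
        and b = "\<lambda>\<rho>. v\<^sub>0 * ln \<rho> + \<kappa> * ln (- ln \<rho>)" and b' = "\<lambda>\<rho>. v\<^sub>0 / \<rho> + \<kappa> / (\<rho> * ln \<rho>)" and S = T])
    fix t assume t: "0 < t" "t < T"
    define s where "s = - ln (r t)"
    have r: "0 < r t" "r t < 1" using r_pos[OF t] r_less_1[OF t] by auto
    then have s: "s > 0" "ln (r t) = - s" unfolding s_def by auto
    show "((\<lambda>\<rho>. - ln \<rho> / \<rho>) has_real_derivative (ln (r t) - 1) / (r t)\<^sup>2) (at (r t))"
      using r by (auto intro!: derivative_eq_intros simp: power2_eq_square divide_simps)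
    show "((\<lambda>\<rho>. v\<^sub>0 * ln \<rho> + \<kappa> * ln (- ln \<rho>)) has_real_derivative v\<^sub>0 / r t + \<kappa> / (r t * ln (r t))) (at (r t))"
      using r by (auto intro!: derivative_eq_intros simp: field_simps)
    show "0 < - ln (r t) / r t" using r by (intro divide_pos_pos) auto
    define z where "z = k0 \<alpha> - b1 / (ln (r t))\<^sup>2 - v t"
    note zb = logarithmic_slope_bound[OF t b, folded z_def]
    define w where "w = v t - v\<^sub>0"
    have w: "w \<ge> 0" using v_ge_critical[OF t] by (simp add: w_def)
    have zc: "c - z = w + b1 / (ln (r t))\<^sup>2" unfolding z_def w_def k0_eq[OF alpha_pos] by simp
    then have "w \<le> c - z" "z \<le> c" using w b by (auto simp: field_simps)
    then have "w\<^sup>2 \<le> (z - c)\<^sup>2" using w power_mono[of w "c - z" 2] by (simp add: power2_commute)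
    then have "?A * w\<^sup>2 \<le> ?A * (z - c)\<^sup>2" using A by (intro mult_left_mono) auto
    then have main: "b1 / s\<^sup>2 + ?A * w\<^sup>2 \<le> z powr (-\<alpha>) - v t"
      using zb(4)[of c] \<open>z \<le> c\<close> s by simp
    have "0 < (?A * (s * w)\<^sup>2 - s * w + b2) / s" using quad[of "s * w"] s by simp
    also have "\<dots> = s * (b1 / s\<^sup>2 + ?A * w\<^sup>2) - w - \<kappa> / s"
      using s unfolding \<kappa>_def by (simp add: field_simps power2_eq_square)
    also have "\<dots> \<le> s * (z powr (-\<alpha>) - v t) - w - \<kappa> / s" using main s by simp
    finally have "0 < (s * (z powr (-\<alpha>) - v t) - w - \<kappa> / s) / r t" using r by simp
    also have "\<dots> = (ln (r t) - 1) / (r t)\<^sup>2 * h t + - ln (r t) / r t * z powr - \<alpha>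
        + (v\<^sub>0 / r t + \<kappa> / (r t * ln (r t)))"
      unfolding w_def s(2) using s r by (simp add: field_simps power2_eq_square)
    finally show "\<exists>z>0. x t < r t * z \<and> 0 < (ln (r t) - 1) / (r t)\<^sup>2 * h t + - ln (r t) / r t * z powr - \<alpha>
        + (v\<^sub>0 / r t + \<kappa> / (r t * ln (r t)))"
      using zb(1,2) by blast
  qed (use that in auto)
  have "filterlim (\<lambda>t. ln (- ln (r t))) at_top (at_right 0)"
    by (rule filterlim_compose[OF ln_at_top neg_ln_r_at_top])
  then have "eventually (\<lambda>t. ln (- ln (r t)) > ?Q (T/2) / \<kappa>) (at_right 0)"
    by (auto simp: filterlim_at_top_dense)
  moreover have "eventually (\<lambda>t. 0 < t \<and> t < T/2) (at_right 0)"
    using T_pos by (auto simp: eventually_at_right_field intro!: exI[of _ "T/2"])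
  ultimately have "eventually (\<lambda>t. False) (at_right (0::real))"
  proof eventually_elim
    case (elim t)
    have t: "0 < t" "t < T" using elim T_pos by auto
    have "0 \<le> (- ln (r t)) * (v t - v\<^sub>0)"
      using v_ge_critical[OF t] r_pos[OF t] r_less_1[OF t] by (intro mult_nonneg_nonneg) auto
    then have "\<kappa> * ln (- ln (r t)) \<le> ?Q t" by (simp add: algebra_simps)
    also have "\<dots> \<le> ?Q (T/2)" using elim T_pos by (intro mono) auto
    finally show False using elim kap by (simp add: field_simps)
  qed
  then show False by simp
qed

end

section \<open>From solutions of the integral equation to trajectories\<close>

lemma locally_L1_on_compact:
  assumes "locally_L1 h S" "compact K" "K \<subseteq> S"
  shows "set_integrable lebesgue K (\<lambda>s. real_of_ereal (h s))"
    and "AE s in lebesgue. s \<in> K \<longrightarrow> \<bar>h s\<bar> \<noteq> \<infinity>"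
proof -
  let ?R = "restrict_space lebesgue K"
  have K: "K \<in> sets lebesgue" using assms(2) by (simp add: compact_imp_closed)
  have h[measurable]: "h \<in> borel_measurable ?R" and "(\<integral>\<^sup>+ s \<in> K. e2ennreal \<bar>h s\<bar> \<partial>lebesgue) < \<infinity>"
    using assms unfolding locally_L1_def by auto
  then have fin: "(\<integral>\<^sup>+ s. e2ennreal \<bar>h s\<bar> \<partial>?R) < \<infinity>"
    using K by (simp add: nn_integral_restrict_space)
  have "integrable ?R (\<lambda>s. real_of_ereal (h s))"
  proof (rule integrableI_bounded)
    have "(\<integral>\<^sup>+ s. ennreal (norm (real_of_ereal (h s))) \<partial>?R) \<le> (\<integral>\<^sup>+ s. e2ennreal \<bar>h s\<bar> \<partial>?R)"
    proof (rule nn_integral_mono)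
      fix s show "ennreal (norm (real_of_ereal (h s))) \<le> e2ennreal \<bar>h s\<bar>"
        by (cases "h s") simp_all
    qed
    then show "(\<integral>\<^sup>+ s. ennreal (norm (real_of_ereal (h s))) \<partial>?R) < \<infinity>" using fin by (rule le_less_trans)
  qed measurable
  then show "set_integrable lebesgue K (\<lambda>s. real_of_ereal (h s))"
    unfolding set_integrable_def using K by (simp add: integrable_restrict_space)
  have "AE s in ?R. e2ennreal \<bar>h s\<bar> \<noteq> \<infinity>"
    by (rule nn_integral_PInf_AE) (use fin in auto)
  then have "AE s in ?R. \<bar>h s\<bar> \<noteq> \<infinity>"
    by eventually_elim (metis e2ennreal_infty infinity_ennreal_def)
  then show "AE s in lebesgue. s \<in> K \<longrightarrow> \<bar>h s\<bar> \<noteq> \<infinity>"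
    using K by (simp add: AE_restrict_space_iff)
qed

lemma set_lebesgue_integral_split:
  fixes q :: "real \<Rightarrow> real"
  assumes "set_integrable lebesgue {a..d} q" "a \<le> b" "b \<le> d"
  shows "(LINT s:{a..d}|lebesgue. q s) = (LINT s:{a..b}|lebesgue. q s) + (LINT s:{b..d}|lebesgue. q s)"
proof -
  have "set_integrable lebesgue {a..b} q" "set_integrable lebesgue {b..d} q"
    using assms by (auto intro: set_integrable_subset)
  with assms show ?thesis
    by (simp add: set_lebesgue_integral_eq_integral Henstock_Kurzweil_Integration.integral_combine)
qed

lemma set_integral_nonpos_AE:
  fixes q :: "real \<Rightarrow> real"
  assumes "AE s in lebesgue. s \<in> A \<longrightarrow> q s \<le> 0"
  shows "(LINT s:A|lebesgue. q s) \<le> 0"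
proof -
  have "0 \<le> (LINT s|lebesgue. - (indicator A s *\<^sub>R q s))"
    using assms by (intro integral_nonneg_AE) (auto elim!: eventually_mono split: split_indicator)
  then show ?thesis by (simp add: set_lebesgue_integral_def)
qed

lemma esssup_nonpos_imp_AE:
  fixes g :: "real \<Rightarrow> real"
  assumes "esssup (restrict_space lebesgue {t::real. 0 < t \<and> ereal t < \<tau>}) (\<lambda>t. ereal (g t)) \<le> 0"
    and "ereal T \<le> \<tau>"
  shows "AE t in lebesgue. t \<in> {0<..<T} \<longrightarrow> g t \<le> 0"
proof -
  let ?S = "{t::real. 0 < t \<and> ereal t < \<tau>}"
  have S: "?S \<in> sets lebesgue"
  proof -
    have "?S = {0<..} \<inter> ereal -` {..<\<tau>}" by auto
    moreover have "open ..." by (intro open_Int open_ereal_vimage) auto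
    ultimately show ?thesis by simp
  qed
  have "AE t in restrict_space lebesgue ?S. g t \<le> 0"
    using esssup_AE[of "\<lambda>t. ereal (g t)"]
  proof eventually_elim
    case (elim t)
    then have "ereal (g t) \<le> 0" using assms(1) by (rule order_trans)
    then show ?case by simp
  qed
  then have "AE t in lebesgue. t \<in> ?S \<longrightarrow> g t \<le> 0" using S by (simp add: AE_restrict_space_iff)
  then show ?thesis
  proof (rule AE_mp, intro AE_I2 impI)
    fix t assume a: "t \<in> ?S \<longrightarrow> g t \<le> 0" "t \<in> {0<..<T}"
    then have "ereal t < \<tau>" using assms(2) less_le_trans[of "ereal t" "ereal T" \<tau>] by simp
    then show "g t \<le> 0" using a by auto
  qed
qed

lemma integrand_nonpos:
  assumes "g s \<le> 0"
  shows "real_of_ereal (integrand \<alpha> g s y) \<le> 0"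
  using assms by (simp add: integrand_def divide_nonpos_nonneg)

text \<open>Where \<open>x s = 0\<close> and \<open>g s < 0\<close> the integrand is infinite, which integrability permits only on a
  null set; where \<open>x s = g s = 0\<close> both sides vanish. So zeros of the solution do not spoil the
  pointwise comparison.\<close>
lemma increment_lower_bound:
  assumes x: "\<And>s. s \<in> {t..t'} \<Longrightarrow> 0 \<le> x s \<and> x s < y" and "\<alpha> > 0"
    and int: "set_integrable lebesgue {t..t'} g"
      "set_integrable lebesgue {t..t'} (\<lambda>s. real_of_ereal (integrand \<alpha> g s (x s)))"
    and fin: "AE s in lebesgue. s \<in> {t..t'} \<longrightarrow> \<bar>integrand \<alpha> g s (x s)\<bar> \<noteq> \<infinity>"
    and g: "AE s in lebesgue. s \<in> {t..t'} \<longrightarrow> g s \<le> 0"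
  shows "(LINT s:{t..t'}|lebesgue. real_of_ereal (integrand \<alpha> g s (x s)))
       \<le> y powr (-\<alpha>) * (LINT s:{t..t'}|lebesgue. g s)"
proof -
  have "(LINT s:{t..t'}|lebesgue. real_of_ereal (integrand \<alpha> g s (x s)))
     \<le> (LINT s:{t..t'}|lebesgue. y powr (-\<alpha>) * g s)"
  proof (rule set_integral_mono_AE)
    show "AE s\<in>{t..t'} in lebesgue. real_of_ereal (integrand \<alpha> g s (x s)) \<le> y powr - \<alpha> * g s"
      using fin g
    proof eventually_elim
      case (elim s)
      show ?case
      proof
        assume s: "s \<in> {t..t'}"
        show "real_of_ereal (integrand \<alpha> g s (x s)) \<le> y powr - \<alpha> * g s"
        proof (cases "x s > 0")
          case True
          have "y powr - \<alpha> \<le> x s powr - \<alpha>"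
            using True x[OF s] assms(2) by (intro powr_mono2') auto
          then have "x s powr - \<alpha> * g s \<le> y powr - \<alpha> * g s"
            using elim s by (intro mult_right_mono_neg) auto
          then show ?thesis using True by (simp add: integrand_def powr_minus_divide)
        next
          case False
          then show ?thesis using elim s by (auto simp: integrand_def split: if_splits)
        qed
      qed
    qed
  qed (use int in auto)
  then show ?thesis by simp
qed

lemma G_of_powr:
  assumes "\<alpha> > 0"
  shows "G_of \<alpha> g t powr (\<alpha> + 1) = (\<alpha> + 1) * \<bar>LINT s:{0<..<t}|lebesgue. g s\<bar>"
proof -
  have "1 / (\<alpha> + 1) * (\<alpha> + 1) = 1" using assms by simp
  then show ?thesis unfolding G_of_def powr_powr using assms by (simp add: abs_mult)
qed

text \<open>A Lebesgue integrable \<open>g\<close> is Henstock-Kurzweil integrable with the same integrals, and for that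
  integral the primitive on a closed interval is known to be continuous.\<close>
lemma primitive_continuous_and_increments:
  fixes g :: "real \<Rightarrow> real"
  assumes "set_integrable lebesgue {0<..<T} g" "T > 0"
  shows "continuous_on {0..T} (\<lambda>t. LINT s:{0<..<t}|lebesgue. g s)"
    and "\<And>t t'. 0 < t \<Longrightarrow> t \<le> t' \<Longrightarrow> t' < T \<Longrightarrow>
      (LINT s:{0<..<t'}|lebesgue. g s) - (LINT s:{0<..<t}|lebesgue. g s) = (LINT s:{t..t'}|lebesgue. g s)"
proof -
  have "g integrable_on {0<..<T}" using assms(1) set_lebesgue_integral_eq_integral(1) by blast
  then have ig: "g integrable_on {0..T}" by (simp add: integrable_on_open_interval_real)
  have U: "(LINT s:{0<..<t}|lebesgue. g s) = integral {0..t} g" if "t \<in> {0..T}" for t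
  proof -
    have "set_integrable lebesgue {0<..<t} g"
      by (rule set_integrable_subset[OF assms(1)]) (use that in auto)
    then show ?thesis
      by (simp add: set_lebesgue_integral_eq_integral integral_open_interval_real)
  qed
  show "continuous_on {0..T} (\<lambda>t. LINT s:{0<..<t}|lebesgue. g s)"
    by (subst continuous_on_cong[OF refl U]) (use indefinite_integral_continuous_1[OF ig] in auto)
  fix t t' assume t: "0 < t" "t \<le> t'" "t' < T"
  have "g integrable_on {0..t'}" using ig by (rule integrable_subinterval_real) (use t in auto)
  moreover have "set_integrable lebesgue {t..t'} g"
    by (rule set_integrable_subset[OF assms(1)]) (use t in auto)
  ultimately show "(LINT s:{0<..<t'}|lebesgue. g s) - (LINT s:{0<..<t}|lebesgue. g s) = (LINT s:{t..t'}|lebesgue. g s)"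
    using t Henstock_Kurzweil_Integration.integral_combine[of 0 t t' g]
    by (simp add: U set_lebesgue_integral_eq_integral)
qed

section \<open>Nonexistence\<close>

theorem theorem2p8:
  fixes \<alpha> \<beta> :: real and f g :: "real \<Rightarrow> real" and \<tau> :: ereal
  assumes "\<alpha> > 0"
    and "continuous_on {0..} f"
    and "f 0 \<ge> 0"
    and "\<And>T::real. T > 0 \<Longrightarrow> set_integrable lebesgue {0<..<T} g"
    and "\<tau> > 0"
    and "esssup (restrict_space lebesgue {t::real. 0 < t \<and> ereal t < \<tau>}) (\<lambda>t. ereal (g t)) \<le> 0"
    and "\<And>t::real. 0 < t \<Longrightarrow> ereal t < \<tau> \<Longrightarrow> G_of \<alpha> g t > 0"
    and "\<beta> > K0 \<alpha>"
    and "\<And>t::real. 0 < t \<Longrightarrow> ereal t < \<tau> \<Longrightarrow> L_defined \<alpha> g t \<Longrightarrow>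
           f t \<le> k0 \<alpha> * G_of \<alpha> g t - \<beta> * G_of \<alpha> g t * (L_of \<alpha> g t)\<^sup>2"
  shows "\<not> (\<exists>\<delta>>0. \<exists>x. is_solution \<alpha> f g \<delta> x)"
proof
  assume "\<exists>\<delta>>0. \<exists>x. is_solution \<alpha> f g \<delta> x"
  then obtain \<delta> x where \<delta>: "\<delta> > 0" and sol: "is_solution \<alpha> f g \<delta> x" by blast
  define J where "J = (\<lambda>s. real_of_ereal (integrand \<alpha> g s (x s)))"
  define U where "U = (\<lambda>t. LINT s:{0<..<t}|lebesgue. g s)"
  define r where "r = G_of \<alpha> g"
  define h where "h = (\<lambda>t. f t - x t)"
  have sol_x: "\<forall>t\<in>{0..<\<delta>}. 0 \<le> x t" and x_cont: "continuous_on {0..<\<delta>} x"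
    and locJ: "locally_L1 (\<lambda>s. integrand \<alpha> g s (x s)) {0<..<\<delta>}"
    and sol_eq: "\<forall>t\<in>{0<..<\<delta>}. \<exists>l.
        ((\<lambda>\<epsilon>. LINT s:{\<epsilon>..t}|lebesgue. J s) \<longlongrightarrow> l) (at_right 0) \<and> x t = f t + l"
    using sol unfolding is_solution_def J_def by blast+
  \<comment> \<open>\<open>\<tau>\<close> may be infinite, and \<open>L\<close> misbehaves where \<open>G = 1\<close>; a short interval with \<open>G < 1\<close> avoids both.\<close>
  obtain T0 where T0: "0 < T0" "ereal T0 < \<tau>" using ereal_dense2[OF assms(5)] by auto
  have U_cont: "continuous_on {0..T0} U"
    unfolding U_def by (rule primitive_continuous_and_increments(1)[OF assms(4)[OF T0(1)] T0(1)])
  have U_incr: "U t' - U t = (LINT s:{t..t'}|lebesgue. g s)" if "0 < t" "t \<le> t'" "t' < T0" for t t'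
    unfolding U_def using that by (rule primitive_continuous_and_increments(2)[OF assms(4)[OF T0(1)] T0(1)])
  have r_eq: "r t = \<bar>(\<alpha> + 1) * U t\<bar> powr (1 / (\<alpha> + 1))" for t
    by (simp add: r_def G_of_def U_def)
  have r_cont: "continuous_on {0..T0} r"
    unfolding r_eq using assms(1) U_cont by (intro continuous_intros continuous_on_powr') auto
  have "(r \<longlongrightarrow> r 0) (at 0 within {0..T0})" using r_cont T0 by (auto simp: continuous_on_def)
  then have "(r \<longlongrightarrow> r 0) (at_right 0)"
    using T0 by (simp add: at_within_Icc_at_right)
  moreover have "r 0 = 0" by (simp add: r_eq U_def set_lebesgue_integral_def)
  ultimately have r_lim: "(r \<longlongrightarrow> 0) (at_right 0)" by simp
  then have "eventually (\<lambda>t. r t < 1) (at_right 0)" by (rule order_tendstoD(2)) simp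
  then obtain T1 where T1: "T1 > 0" "\<And>t. 0 < t \<Longrightarrow> t < T1 \<Longrightarrow> r t < 1"
    by (auto simp: eventually_at_right_field)
  define T where "T = min T1 (min T0 \<delta>)"
  have T: "T > 0" "T \<le> T1" "T \<le> T0" "T \<le> \<delta>" using T1 T0 \<delta> by (auto simp: T_def)
  have below: "ereal t < \<tau>" if "t < T" for t
    using that T T0(2) less_trans[of "ereal t" "ereal T0" \<tau>] by simp
  have g: "AE s in lebesgue. s \<in> {0<..<T} \<longrightarrow> g s \<le> 0"
    by (rule esssup_nonpos_imp_AE[OF assms(6)]) (use T T0(2) le_less_trans[of "ereal T" "ereal T0" \<tau>] in auto)
  have g': "AE s in lebesgue. s \<in> A \<longrightarrow> g s \<le> 0" if "A \<subseteq> {0<..<T}" for A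
    using g by eventually_elim (use that in auto)
  have U_nonpos: "U t \<le> 0" if "t \<le> T" for t
    unfolding U_def by (rule set_integral_nonpos_AE[OF g']) (use that in auto)
  have U_decr: "U t' - U t \<le> 0" if "0 < t" "t \<le> t'" "t' < T" for t t'
  proof -
    have "{t..t'} \<subseteq> {0<..<T}" using that by auto
    then show ?thesis using U_incr[of t t'] set_integral_nonpos_AE[OF g'] that T by simp
  qed
  have J_nonpos: "AE s in lebesgue. s \<in> A \<longrightarrow> J s \<le> 0" if "A \<subseteq> {0<..<T}" for A
    using g
  proof eventually_elim
    case (elim s)
    then show ?case using that integrand_nonpos[of g s \<alpha> "x s"] unfolding J_def by blast
  qed
  have x: "0 \<le> x t" if "0 \<le> t" "t < T" for t using sol_x that T by simp
  have J_int: "set_integrable lebesgue {a..b} J" and J_fin: "AE s in lebesgue. s \<in> {a..b} \<longrightarrow> \<bar>integrand \<alpha> g s (x s)\<bar> \<noteq> \<infinity>"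
    if "0 < a" "b < T" for a b
  proof -
    have "{a..b} \<subseteq> {0<..<\<delta>}" using that T by auto
    from locally_L1_on_compact[OF locJ compact_Icc this]
    show "set_integrable lebesgue {a..b} J"
      "AE s in lebesgue. s \<in> {a..b} \<longrightarrow> \<bar>integrand \<alpha> g s (x s)\<bar> \<noteq> \<infinity>"
      unfolding J_def by blast+
  qed
  have h_lim: "((\<lambda>\<epsilon>. LINT s:{\<epsilon>..t}|lebesgue. J s) \<longlongrightarrow> - h t) (at_right 0)"
    if t: "0 < t" "t < T" for t
  proof -
    have "\<exists>l. ((\<lambda>\<epsilon>. LINT s:{\<epsilon>..t}|lebesgue. J s) \<longlongrightarrow> l) (at_right 0) \<and> x t = f t + l"
      using bspec[OF sol_eq, of t] t T by simp
    then obtain l where l: "((\<lambda>\<epsilon>. LINT s:{\<epsilon>..t}|lebesgue. J s) \<longlongrightarrow> l) (at_right 0)"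
      "x t = f t + l" by blast
    then have "l = - h t" by (simp add: h_def)
    with l show ?thesis by simp
  qed
  have evt: "eventually (\<lambda>\<epsilon>. 0 < \<epsilon> \<and> \<epsilon> < t) (at_right 0)" if "0 < t" for t :: real
    using that by (auto simp: eventually_at_right_field)
  \<comment> \<open>The integral from \<open>0\<close> is only a limit, but its increments are honest integrals.\<close>
  have h_incr: "h t' - h t = - (LINT s:{t..t'}|lebesgue. J s)"
    if t: "0 < t" "t \<le> t'" "t' < T" for t t'
  proof -
    have "((\<lambda>\<epsilon>. (LINT s:{\<epsilon>..t'}|lebesgue. J s) - (LINT s:{\<epsilon>..t}|lebesgue. J s)) \<longlongrightarrow> - h t' - - h t) (at_right 0)"
      by (intro tendsto_diff h_lim) (use t in auto)
    moreover have "eventually (\<lambda>\<epsilon>. (LINT s:{\<epsilon>..t'}|lebesgue. J s) - (LINT s:{\<epsilon>..t}|lebesgue. J s)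
        = (LINT s:{t..t'}|lebesgue. J s)) (at_right 0)"
      using evt[OF t(1)]
    proof eventually_elim
      case (elim \<epsilon>)
      then show ?case using set_lebesgue_integral_split[OF J_int, of \<epsilon> t' t] t by simp
    qed
    ultimately have "((\<lambda>\<epsilon>. LINT s:{t..t'}|lebesgue. J s) \<longlongrightarrow> - h t' - - h t) (at_right (0::real))"
      by (rule Lim_transform_eventually)
    then show ?thesis by (simp add: tendsto_const_iff)
  qed
  have "subcritical_forcing \<alpha> T r h x \<beta>"
  proof
    show "0 < \<alpha>" "0 < T" "K0 \<alpha> < \<beta>" "(r \<longlongrightarrow> 0) (at_right 0)" using assms T r_lim by auto
    show "continuous_on {0<..<T} r" using r_cont by (rule continuous_on_subset) (use T in auto)
    have xc: "continuous_on {0<..<T} x"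
      using x_cont by (rule continuous_on_subset) (use T in auto)
    then show "continuous_on {0<..<T} x" .
    have "continuous_on {0<..<T} f" using assms(2) by (rule continuous_on_subset) auto
    then show "continuous_on {0<..<T} h" unfolding h_def using xc by (intro continuous_intros)
    show rpos: "0 < r t" if "0 < t" "t < T" for t
      unfolding r_def using assms(7) below that by auto
    show r1: "r t < 1" if "0 < t" "t < T" for t using T1(2) that T by auto
    show "0 \<le> x t" if "0 < t" "t < T" for t using x that by auto
    show "0 \<le> h t" if "0 < t" "t < T" for t
    proof -
      have "- h t \<le> 0"
      proof (rule tendsto_upperbound[OF h_lim[OF that]])
        show "eventually (\<lambda>\<epsilon>. (LINT s:{\<epsilon>..t}|lebesgue. J s) \<le> 0) (at_right 0)"
          using evt[OF that(1)]
          by eventually_elim (use that in \<open>auto intro!: set_integral_nonpos_AE J_nonpos\<close>)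
      qed simp
      then show ?thesis by simp
    qed
    show "x t + h t \<le> k0 \<alpha> * r t - \<beta> * r t * (1 / \<bar>ln (r t)\<bar>)\<^sup>2" if t: "0 < t" "t < T" for t
    proof -
      have "L_defined \<alpha> g t" using rpos[OF t] r1[OF t] by (simp add: L_defined_def r_def)
      from assms(9)[OF t(1) below[OF t(2)] this] show ?thesis by (simp add: h_def r_def L_of_def)
    qed
    fix t t' assume t: "0 < t" "t \<le> t'" "t' < T"
    have Ut: "U t \<le> 0" "U t' \<le> U t" using U_nonpos U_decr[OF t] t by auto
    then have "\<bar>(\<alpha> + 1) * U t\<bar> \<le> \<bar>(\<alpha> + 1) * U t'\<bar>" using assms(1) by (simp add: abs_mult)
    then show "r t \<le> r t'"
      unfolding r_eq using assms(1) by (intro powr_mono2) auto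
    fix y :: real assume y: "0 < y" "\<forall>s\<in>{t..t'}. x s < y"
    have "(r t' powr (\<alpha> + 1) - r t powr (\<alpha> + 1)) / (\<alpha> + 1) = - (U t' - U t)"
    proof -
      have "r s powr (\<alpha> + 1) = (\<alpha> + 1) * \<bar>U s\<bar>" for s
        unfolding r_def U_def by (rule G_of_powr[OF assms(1)])
      then show ?thesis using Ut assms(1) by (simp add: right_diff_distrib[symmetric] del: right_diff_distrib)
    qed
    also have "U t' - U t = (LINT s:{t..t'}|lebesgue. g s)" using U_incr t T by auto
    finally have eq: "(r t' powr (\<alpha> + 1) - r t powr (\<alpha> + 1)) / (\<alpha> + 1) = - (LINT s:{t..t'}|lebesgue. g s)" .
    have "(LINT s:{t..t'}|lebesgue. J s) \<le> y powr (-\<alpha>) * (LINT s:{t..t'}|lebesgue. g s)"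
      unfolding J_def
    proof (rule increment_lower_bound)
      show "set_integrable lebesgue {t..t'} g"
        by (rule set_integrable_subset[OF assms(4)[OF T(1)]]) (use t in auto)
      show "AE s in lebesgue. s \<in> {t..t'} \<longrightarrow> g s \<le> 0" by (rule g') (use t in auto)
      show "set_integrable lebesgue {t..t'} (\<lambda>s. real_of_ereal (integrand \<alpha> g s (x s)))"
        by (rule J_int[unfolded J_def, OF t(1,3)])
      show "AE s in lebesgue. s \<in> {t..t'} \<longrightarrow> \<bar>integrand \<alpha> g s (x s)\<bar> \<noteq> \<infinity>"
        by (rule J_fin[OF t(1,3)])
      show "0 \<le> x s \<and> x s < y" if "s \<in> {t..t'}" for s
        using y(2) that x[of s] t by simp
    qed (rule assms(1))
    then show "y powr - \<alpha> * ((r t' powr (\<alpha> + 1) - r t powr (\<alpha> + 1)) / (\<alpha> + 1)) \<le> h t' - h t"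
      unfolding eq h_incr[OF t] by simp
  qed
  then interpret subcritical_forcing \<alpha> T r h x \<beta> .
  show False by (rule no_trajectory)
qed

end
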